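(* Let $R$ be a ranking profile over $m$ candidates and $\rhd$ the ranking chosen by the Flow-adjusting Borda rule for $R$. Then for every subprofile $S$ of $R$ with $|S|>0$, $$\frac{1}{|S|}\sum_{\succ\in\mathcal{R}}S(\succ)u(\succ,\rhd)\geq\binom{m}{2}\frac{|S|}{4}-\frac{3}{16}.$$
   Context: Let $C$ be a set of $m$ candidates. A ranking is a strict linear order over $C$; $\mathcal{R}$ denotes the set of all rankings over $C$. A ranking profile is a function $R:\mathcal{R}\to[0,1]$ with $\sum_\succ R(\succ)=1$; a subprofile of $R$ is $S:\mathcal{R}\to[0,1]$ with $S(\succ)\leq R(\succ)$ for all $\succ$, and $|S|=\sum_\succ S(\succ)$. For rankings $\succ,\rhd$, $u(\succ,\rhd)=|\{(x,y)\in C^2:x\succ y\text{ and }x\rhd y\}|$; for $x\in X\subseteq C$, $u(\succ,x,X)=|\{y\in X\setminus\{x\}:x\succ y\}|$; for $b:\mathcal{R}\to\mathbb{R}_{\geq0}$, $U(b,x,X)=\sum_\succ b(\succ)u(\succ,x,X)$. Flow-adjusting Borda rule: set $X_1=C$, $b_1(\succ)=R(\succ)\binom{m}{2}$. In round $i=1,\dots,m$: choose $x^*\in\arg\max_{x\in X_i}U(b_i,x,X_i)$ (ties arbitrary), place it at position $i$, set $X_{i+1}=X_i\setminus\{x^*\}$. Build the flow network $G_{x^*}$ with source $s$, a vertex $v_\succ$ for each $\succ\in\mathcal{R}$, a vertex $v_y$ for each $y\in X_i\setminus\{x^*\}$, and sink $t$; edges $(s,v_\succ)$ of capacity $b_i(\succ)$,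 edges $(v_\succ,v_y)$ of unbounded capacity whenever $x^*\succ y$, and edges $(v_y,t)$ of capacity $1$. Choose a maximum $s$-$t$ flow $f$ in $G_{x^*}$ that, among all maximum flows, minimizes $\max_{\succ\in\mathcal{R}}\frac{f(s,v_\succ)}{b_i(\succ)\,u(\succ,x^*,X_i)}$ (convention $0/0=0$), and set $b_{i+1}(\succ)=b_i(\succ)-f(s,v_\succ)$. *)

theory Defs
  imports Complex_Main
begin

text \<open>Rankings over C: strict linear orders on C, as relations (x,y) \<in> r meaning x is ranked above y.\<close>
definition rankings :: "'a set \<Rightarrow> 'a rel set" where
  "rankings C = {r. r \<subseteq> C \<times> C \<and> strict_linear_order_on C r}"

definition is_profile :: "'a set \<Rightarrow> ('a rel \<Rightarrow> real) \<Rightarrow> bool" where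
  "is_profile C R \<longleftrightarrow> (\<forall>r\<in>rankings C. 0 \<le> R r \<and> R r \<le> 1) \<and> (\<Sum>r\<in>rankings C. R r) = 1"

definition u_pair :: "'a rel \<Rightarrow> 'a rel \<Rightarrow> nat" where
  "u_pair r s = card {(x, y). (x, y) \<in> r \<and> (x, y) \<in> s}"

definition u_cand :: "'a rel \<Rightarrow> 'a \<Rightarrow> 'a set \<Rightarrow> nat" where
  "u_cand r x X = card {y \<in> X - {x}. (x, y) \<in> r}"

definition U_score :: "'a set \<Rightarrow> ('a rel \<Rightarrow> real) \<Rightarrow> 'a \<Rightarrow> 'a set \<Rightarrow> real" where
  "U_score C b x X = (\<Sum>r\<in>rankings C. b r * real (u_cand r x X))"

text \<open>A flow in the network G_x (round with remaining set X, budgets b) is given by its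
  values g r y on the middle edges (v_r, v_y); the flow on (s, v_r) is the sum of the
  outgoing flow (conservation at v_r) and the flow on (v_y, t) is the sum of the incoming
  flow (conservation at v_y).\<close>
definition src_flow :: "'a set \<Rightarrow> 'a \<Rightarrow> ('a rel \<Rightarrow> 'a \<Rightarrow> real) \<Rightarrow> 'a rel \<Rightarrow> real" where
  "src_flow X x g r = (\<Sum>y\<in>X - {x}. g r y)"

definition is_flow :: "'a set \<Rightarrow> ('a rel \<Rightarrow> real) \<Rightarrow> 'a set \<Rightarrow> 'a \<Rightarrow> ('a rel \<Rightarrow> 'a \<Rightarrow> real) \<Rightarrow> bool" where
  "is_flow C b X x g \<longleftrightarrow>
     (\<forall>r\<in>rankings C. \<forall>y\<in>X - {x}. 0 \<le> g r y \<and> ((x, y) \<notin> r \<longrightarrow> g r y = 0)) \<and>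
     (\<forall>r\<in>rankings C. src_flow X x g r \<le> b r) \<and>
     (\<forall>y\<in>X - {x}. (\<Sum>r\<in>rankings C. g r y) \<le> 1)"

definition flow_value :: "'a set \<Rightarrow> 'a set \<Rightarrow> 'a \<Rightarrow> ('a rel \<Rightarrow> 'a \<Rightarrow> real) \<Rightarrow> real" where
  "flow_value C X x g = (\<Sum>r\<in>rankings C. src_flow X x g r)"

definition is_max_flow :: "'a set \<Rightarrow> ('a rel \<Rightarrow> real) \<Rightarrow> 'a set \<Rightarrow> 'a \<Rightarrow> ('a rel \<Rightarrow> 'a \<Rightarrow> real) \<Rightarrow> bool" where
  "is_max_flow C b X x g \<longleftrightarrow> is_flow C b X x g \<and>
     (\<forall>g'. is_flow C b X x g' \<longrightarrow> flow_value C X x g' \<le> flow_value C X x g)"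

text \<open>max over rankings of f(s,v_r) / (b(r) u(r,x,X)); Isabelle's x/0 = 0 matches the convention 0/0 = 0
  (a positive numerator with zero denominator cannot occur for a flow).\<close>
definition max_ratio :: "'a set \<Rightarrow> ('a rel \<Rightarrow> real) \<Rightarrow> 'a set \<Rightarrow> 'a \<Rightarrow> ('a rel \<Rightarrow> 'a \<Rightarrow> real) \<Rightarrow> real" where
  "max_ratio C b X x g = Max ((\<lambda>r. src_flow X x g r / (b r * real (u_cand r x X))) ` rankings C)"

definition is_chosen_flow :: "'a set \<Rightarrow> ('a rel \<Rightarrow> real) \<Rightarrow> 'a set \<Rightarrow> 'a \<Rightarrow> ('a rel \<Rightarrow> 'a \<Rightarrow> real) \<Rightarrow> bool" where
  "is_chosen_flow C b X x g \<longleftrightarrow> is_max_flow C b X x g \<and>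
     (\<forall>g'. is_max_flow C b X x g' \<longrightarrow> max_ratio C b X x g \<le> max_ratio C b X x g')"

text \<open>A run of the flow-adjusting Borda rule: xs lists the candidates in the order chosen
  (xs ! i is placed at position i+1), b i is the budget function b_{i+1} of the paper.
  All tie-breaking choices (argmax candidate, optimal flow) are arbitrary.\<close>
definition FAB_run :: "'a set \<Rightarrow> ('a rel \<Rightarrow> real) \<Rightarrow> 'a list \<Rightarrow> (nat \<Rightarrow> 'a rel \<Rightarrow> real) \<Rightarrow> bool" where
  "FAB_run C R xs b \<longleftrightarrow> distinct xs \<and> set xs = C \<and>
     (\<forall>r\<in>rankings C. b 0 r = R r * real (card C choose 2)) \<and>
     (\<forall>i < length xs.
        (\<forall>y\<in>C - set (take i xs). U_score C (b i) y (C - set (take i xs))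
                                 \<le> U_score C (b i) (xs ! i) (C - set (take i xs))) \<and>
        (\<exists>g. is_chosen_flow C (b i) (C - set (take i xs)) (xs ! i) g \<and>
             (\<forall>r\<in>rankings C. b (Suc i) r = b i r - src_flow (C - set (take i xs)) (xs ! i) g r)))"

definition ranking_of :: "'a list \<Rightarrow> 'a rel" where
  "ranking_of xs = {(xs ! i, xs ! j) | i j. i < j \<and> j < length xs}"

end

theory Submission
  imports Defs
begin

text \<open>
  Let N = m choose 2, let B be the total budget and q the budget share of S in a round with k
  candidates left. While k \<ge> 4, the Borda winner x satisfies Hall's condition for the supplies
  2/B * b(r) * u(r): rankings placing x above some member of Y supply at least |Y|. Hence the
  chosen flow saturates the sink edges, so B stays equal to k choose 2, and every ranking pays at
  most 2/B * b(r) * u(r). As b(r) \<le> N * R(r), a payment p by S is matched by a utility of at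
  least p * B / (2N) \<ge> (q^2 - (q - p)^2) / (4N), which telescopes.

  With three candidates left (B = 3) the maximum flow may fail to saturate, but it has value at
  least 3/2, and with two candidates left the winner is supported by half of the remaining budget.
  Thus, if S holds the budget Q when three candidates are left, these two rounds give S a utility
  of at least max(0, Q - 3/4) / N \<ge> (Q^2 / 4 - 3 Q / 16) / N. The initial budget of S is N |S|.
\<close>

section \<open>Transportation with Hall's condition\<close>

definition nbrs :: "('r \<Rightarrow> 'y \<Rightarrow> bool) \<Rightarrow> 'r set \<Rightarrow> 'y set \<Rightarrow> 'r set" where
  "nbrs E A Z = {r \<in> A. \<exists>y\<in>Z. E r y}"

text \<open>\<open>g\<close> is required to vanish everywhere off the edges between \<open>A\<close>
  and \<open>Y\<close>, so a solution of a subinstance is literally a function on the whole instance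
  and solutions can be added pointwise. Demands are met exactly, supplies are only upper
  bounds.\<close>

definition transport ::
  "('r \<Rightarrow> 'y \<Rightarrow> bool) \<Rightarrow> 'r set \<Rightarrow> 'y set \<Rightarrow> ('r \<Rightarrow> real) \<Rightarrow> ('y \<Rightarrow> real) \<Rightarrow> ('r \<Rightarrow> 'y \<Rightarrow> real) \<Rightarrow> bool" where
  "transport E A Y c d g \<longleftrightarrow>
     (\<forall>r y. 0 \<le> g r y) \<and> (\<forall>r y. g r y \<noteq> 0 \<longrightarrow> r \<in> A \<and> y \<in> Y \<and> E r y) \<and>
     (\<forall>r\<in>A. (\<Sum>y\<in>Y. g r y) \<le> c r) \<and> (\<forall>y\<in>Y. (\<Sum>r\<in>A. g r y) = d y)"

lemma finite_nbrs: "finite A \<Longrightarrow> finite (nbrs E A Z)"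
  by (simp add: nbrs_def)

text \<open>Puts back a deleted vertex: a further supplier may stay idle, and a further consumer
  asks for nothing.\<close>

lemma transport_extend:
  assumes "finite A" "finite Y" "A' \<subseteq> A" "Y' \<subseteq> Y" "\<forall>r\<in>A. 0 \<le> c r"
    and g: "transport E A' Y' c d g" and "\<forall>y\<in>Y - Y'. d y = 0"
  shows "transport E A Y c d g"
proof -
  have supp: "\<And>r y. g r y \<noteq> 0 \<Longrightarrow> r \<in> A' \<and> y \<in> Y' \<and> E r y"
    using g by (auto simp: transport_def)
  have 1: "(\<Sum>y\<in>Y. g r y) = (\<Sum>y\<in>Y'. g r y)" for r
    using assms supp by (intro sum.mono_neutral_right) blast+
  have 2: "(\<Sum>r\<in>A. g r y) = (\<Sum>r\<in>A'. g r y)" for y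
    using assms supp by (intro sum.mono_neutral_right) blast+
  have "(\<Sum>y\<in>Y'. g r y) \<le> c r" if "r \<in> A" for r
  proof (cases "r \<in> A'")
    case True
    then show ?thesis using g by (simp add: transport_def)
  next
    case False
    then have "(\<Sum>y\<in>Y'. g r y) = 0" using supp by (intro sum.neutral) blast
    then show ?thesis using assms that by simp
  qed
  moreover have "(\<Sum>r\<in>A'. g r y) = d y" if "y \<in> Y" for y
  proof (cases "y \<in> Y'")
    case True
    then show ?thesis using g by (simp add: transport_def)
  next
    case False
    then have "(\<Sum>r\<in>A'. g r y) = 0" using supp by (intro sum.neutral) blast
    then show ?thesis using assms that False by simp
  qed
  ultimately show ?thesis
    using g supp assms unfolding transport_def 1 2 by blast
qed

text \<open>Recombines the two halves of an instance split at a tight set; each half vanishes on the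
  vertices of the other, so no constraint mixes them.\<close>

lemma transport_disjoint_union:
  assumes "finite A" "finite Y" "A1 \<union> A2 = A" "A1 \<inter> A2 = {}" "Y1 \<union> Y2 = Y" "Y1 \<inter> Y2 = {}"
    and "transport E A1 Y1 c d g1" and "transport E A2 Y2 c d g2"
  shows "transport E A Y c d (\<lambda>r y. g1 r y + g2 r y)"
proof -
  have s1: "\<And>r y. g1 r y \<noteq> 0 \<Longrightarrow> r \<in> A1 \<and> y \<in> Y1 \<and> E r y"
    and s2: "\<And>r y. g2 r y \<noteq> 0 \<Longrightarrow> r \<in> A2 \<and> y \<in> Y2 \<and> E r y"
    using assms by (auto simp: transport_def)
  have a: "(\<Sum>y\<in>Y. g1 r y) = (\<Sum>y\<in>Y1. g1 r y)" "(\<Sum>y\<in>Y. g2 r y) = (\<Sum>y\<in>Y2. g2 r y)" for r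
    using assms s1 s2 by (intro sum.mono_neutral_right; auto)+
  have b: "(\<Sum>r\<in>A. g1 r y) = (\<Sum>r\<in>A1. g1 r y)" "(\<Sum>r\<in>A. g2 r y) = (\<Sum>r\<in>A2. g2 r y)" for y
    using assms s1 s2 by (intro sum.mono_neutral_right; auto)+
  have z1: "(\<Sum>y\<in>Y1. g1 r y) = 0" if "r \<notin> A1" for r using s1 that by (intro sum.neutral) blast
  have z2: "(\<Sum>y\<in>Y2. g2 r y) = 0" if "r \<notin> A2" for r using s2 that by (intro sum.neutral) blast
  have z3: "(\<Sum>r\<in>A1. g1 r y) = 0" if "y \<notin> Y1" for y using s1 that by (intro sum.neutral) blast
  have z4: "(\<Sum>r\<in>A2. g2 r y) = 0" if "y \<notin> Y2" for y using s2 that by (intro sum.neutral) blast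
  have "(\<Sum>y\<in>Y. g1 r y + g2 r y) \<le> c r" if "r \<in> A" for r
  proof (cases "r \<in> A1")
    case True
    then have "r \<notin> A2" using assms by blast
    with True z2[of r] show ?thesis using assms(7) by (simp add: sum.distrib a transport_def)
  next
    case False
    then have "r \<in> A2" using that assms by blast
    with False z1[of r] show ?thesis using assms(8) by (simp add: sum.distrib a transport_def)
  qed
  moreover have "(\<Sum>r\<in>A. g1 r y + g2 r y) = d y" if "y \<in> Y" for y
  proof (cases "y \<in> Y1")
    case True
    then have "y \<notin> Y2" using assms by blast
    with True z4[of y] show ?thesis using assms(7) by (simp add: sum.distrib b transport_def)
  next
    case False
    then have "y \<in> Y2" using that assms by blast
    with False z3[of y] show ?thesis using assms(8) by (simp add: sum.distrib b transport_def)
  qed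
  moreover have "0 \<le> g1 r y + g2 r y" for r y
    using assms(7,8) by (simp add: transport_def)
  moreover have "r \<in> A \<and> y \<in> Y \<and> E r y" if "g1 r y + g2 r y \<noteq> 0" for r y
    using that s1[of r y] s2[of r y] assms(3,5) by fastforce
  ultimately show ?thesis unfolding transport_def by blast
qed

text \<open>Undoes the push of an amount \<open>e\<close> along the edge from \<open>r0\<close> to
  \<open>y0\<close>.\<close>

lemma transport_add_edge:
  fixes c :: "'r \<Rightarrow> real" and d :: "'y \<Rightarrow> real"
  assumes "finite A" "finite Y" "r0 \<in> A" "y0 \<in> Y" "E r0 y0" "0 \<le> e"
    and g: "transport E A Y (c(r0 := c r0 - e)) (d(y0 := d y0 - e)) g"
  shows "\<exists>h. transport E A Y c d h"
proof -
  define h where "h = (\<lambda>r y. g r y + (if r = r0 \<and> y = y0 then e else 0))"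
  have "(\<Sum>y\<in>Y. h r y) = (\<Sum>y\<in>Y. g r y) + (if r = r0 then e else 0)" for r
    using assms by (cases "r = r0") (auto simp: h_def sum.distrib)
  moreover have "(\<Sum>r\<in>A. h r y) = (\<Sum>r\<in>A. g r y) + (if y = y0 then e else 0)" for y
    using assms by (cases "y = y0") (auto simp: h_def sum.distrib)
  moreover have "0 \<le> h r y" "h r y \<noteq> 0 \<Longrightarrow> r \<in> A \<and> y \<in> Y \<and> E r y" for r y
    using assms by (auto simp: h_def transport_def split: if_splits)
  moreover have "(\<Sum>y\<in>Y. g r y) + (if r = r0 then e else 0) \<le> c r" if "r \<in> A" for r
  proof -
    have "(\<Sum>y\<in>Y. g r y) \<le> (c(r0 := c r0 - e)) r" using g that by (simp only: transport_def)
    then show ?thesis by (auto split: if_splits)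
  qed
  moreover have "(\<Sum>r\<in>A. g r y) + (if y = y0 then e else 0) = d y" if "y \<in> Y" for y
  proof -
    have "(\<Sum>r\<in>A. g r y) = (d(y0 := d y0 - e)) y" using g that by (simp only: transport_def)
    then show ?thesis by (auto split: if_splits)
  qed
  ultimately have "transport E A Y c d h" unfolding transport_def by simp
  then show ?thesis by blast
qed

text \<open>
  Either a vertex with zero supply or demand can be dropped, or a tight proper set of demands
  splits the instance in two. In the remaining case one pushes flow along an edge until one of
  these situations occurs.
\<close>
theorem fractional_hall:
  fixes c :: "'r \<Rightarrow> real" and d :: "'y \<Rightarrow> real"
  assumes "finite A" "finite Y" "\<forall>r\<in>A. 0 \<le> c r" "\<forall>y\<in>Y. 0 \<le> d y"
    and "\<forall>Z\<subseteq>Y. sum d Z \<le> sum c (nbrs E A Z)"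
  shows "\<exists>g. transport E A Y c d g"
  using assms
proof (induction "card A + card Y" arbitrary: A Y c d rule: less_induct)
  case less
  note IH = less.hyps
  note finA = less.prems(1) and finY = less.prems(2)
  have reducible: "\<exists>g. transport E A Y c d g"
    if c: "\<forall>r\<in>A. 0 \<le> c r" and d: "\<forall>y\<in>Y. 0 \<le> d y"
      and hall: "\<forall>Z\<subseteq>Y. sum d Z \<le> sum c (nbrs E A Z)"
      and cs: "(\<exists>y\<in>Y. d y = 0) \<or> (\<exists>r\<in>A. c r = 0) \<or>
          (\<exists>Z. Z \<subset> Y \<and> Z \<noteq> {} \<and> sum c (nbrs E A Z) = sum d Z)" for c d
    using cs
  proof (elim disjE bexE exE conjE)
    fix y assume y: "y \<in> Y" "d y = 0"
    have "card (Y - {y}) < card Y" using y finY by (meson card_Diff1_less)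
    then have "\<exists>g. transport E A (Y - {y}) c d g"
      by (intro IH) (use finA finY c d hall in auto)
    then obtain g where "transport E A (Y - {y}) c d g" by blast
    then have "transport E A Y c d g"
      using y finA finY c by (intro transport_extend[of A Y A "Y - {y}"]) auto
    then show ?thesis by blast
  next
    fix r assume r: "r \<in> A" "c r = 0"
    have "card (A - {r}) < card A" using r finA by (meson card_Diff1_less)
    moreover have "sum c (nbrs E (A - {r}) Z) = sum c (nbrs E A Z)" for Z
      using r finA by (intro sum.mono_neutral_left) (auto simp: nbrs_def)
    ultimately have "\<exists>g. transport E (A - {r}) Y c d g"
      by (intro IH) (use finA finY c d hall in auto)
    then obtain g where "transport E (A - {r}) Y c d g" by blast
    then have "transport E A Y c d g"
      using finA finY c by (intro transport_extend[of A Y "A - {r}" Y]) auto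
    then show ?thesis by blast
  next
    fix Z assume Z: "Z \<subset> Y" "Z \<noteq> {}" and tight: "sum c (nbrs E A Z) = sum d Z"
    have finZ: "finite Z" using Z finY finite_subset by blast
    have sub: "nbrs E A Z \<subseteq> A" by (auto simp: nbrs_def)
    have cA: "card (nbrs E A Z) \<le> card A" "card (A - nbrs E A Z) \<le> card A"
      using finA sub by (auto intro: card_mono)
    have cY: "card Z < card Y" "card (Y - Z) < card Y"
      using Z finY by (auto intro!: psubset_card_mono)
    have "\<exists>g. transport E (nbrs E A Z) Z c d g"
    proof (rule IH)
      show "\<forall>Za\<subseteq>Z. sum d Za \<le> sum c (nbrs E (nbrs E A Z) Za)"
      proof (intro allI impI)
        fix W assume "W \<subseteq> Z"
        then have "nbrs E (nbrs E A Z) W = nbrs E A W" "W \<subseteq> Y" using Z by (auto simp: nbrs_def)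
        then show "sum d W \<le> sum c (nbrs E (nbrs E A Z) W)" using hall by simp
      qed
    qed (use cA cY finA finY finZ c d Z sub in \<open>auto simp: finite_nbrs\<close>)
    moreover have "\<exists>g. transport E (A - nbrs E A Z) (Y - Z) c d g"
    proof (rule IH)
      show "\<forall>W\<subseteq>Y - Z. sum d W \<le> sum c (nbrs E (A - nbrs E A Z) W)"
      proof (intro allI impI)
        fix W assume W: "W \<subseteq> Y - Z"
        then have finW: "finite W" using finY finite_subset by blast
        \<comment> \<open>Hall's condition for \<open>W \<union> Z\<close>, minus the tight equality
          for \<open>Z\<close>, is Hall's condition for \<open>W\<close> in the remaining
          instance.\<close>
        have "sum d W + sum d Z = sum d (W \<union> Z)"
          using W finW finZ by (subst sum.union_disjoint) auto
        also have "\<dots> \<le> sum c (nbrs E A (W \<union> Z))" using hall[rule_format, of "W \<union> Z"] W Z by auto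
        also have "nbrs E A (W \<union> Z) = nbrs E (A - nbrs E A Z) W \<union> nbrs E A Z"
          by (auto simp: nbrs_def)
        also have "sum c \<dots> = sum c (nbrs E (A - nbrs E A Z) W) + sum c (nbrs E A Z)"
          using finA by (subst sum.union_disjoint) (auto simp: nbrs_def)
        finally show "sum d W \<le> sum c (nbrs E (A - nbrs E A Z) W)" using tight by simp
      qed
    qed (use cA cY finA finY c d in auto)
    ultimately obtain g1 g2 where "transport E (nbrs E A Z) Z c d g1"
      "transport E (A - nbrs E A Z) (Y - Z) c d g2" by blast
    then show ?thesis
      using transport_disjoint_union[OF finA finY, of "nbrs E A Z" "A - nbrs E A Z" Z "Y - Z"] sub Z
      by blast
  qed
  show ?case
  proof (cases "Y = {}")
    case True
    have "transport E A Y c d (\<lambda>_ _. 0)" using True less.prems by (simp add: transport_def)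
    then show ?thesis by blast
  next
    case False
    then obtain y0 where y0: "y0 \<in> Y" by blast
    show ?thesis
    proof (cases "d y0 = 0")
      case True
      then show ?thesis using reducible less.prems y0 by blast
    next
      case False
      then have "0 < d y0" using less.prems y0 by force
      moreover have "d y0 \<le> sum c (nbrs E A {y0})" using less.prems(5)[rule_format, of "{y0}"] y0 by simp
      ultimately have "nbrs E A {y0} \<noteq> {}" by force
      then obtain r0 where r0: "r0 \<in> A" "E r0 y0" by (auto simp: nbrs_def)
      define slack where "slack Z = sum c (nbrs E A Z) - sum d Z" for Z
      \<comment> \<open>Pushing \<open>e\<close> along the edge lowers the supply available to a set
        exactly if \<open>r0\<close> is a neighbour, and its demand exactly if \<open>y0\<close>
        belongs to it. So only the sets in \<open>K\<close> lose slack.\<close>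
      define K where "K = {Z. Z \<subseteq> Y - {y0} \<and> Z \<noteq> {} \<and> r0 \<in> nbrs E A Z}"
      define M where "M = insert (c r0) (insert (d y0) (slack ` K))"
      \<comment> \<open>The largest push that keeps supplies, demands and slacks nonnegative. The
        minimum is attained, so afterwards a supply or a demand is zero or a set in \<open>K\<close>
        is tight, and the instance is reducible.\<close>
      define e where "e = Min M"
      define c' where "c' = c(r0 := c r0 - e)"
      define d' where "d' = d(y0 := d y0 - e)"
      have "finite K" unfolding K_def using finY by simp
      then have finM: "finite M" by (simp add: M_def)
      have "e \<in> M" unfolding e_def using finM by (intro Min_in) (auto simp: M_def)
      have eM: "e \<le> v" if "v \<in> M" for v unfolding e_def using finM that by simp
      have "0 \<le> slack Z" if "Z \<in> K" for Z using less.prems(5) that by (auto simp: K_def slack_def)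
      then have "0 \<le> e" using \<open>e \<in> M\<close> less.prems y0 r0 by (auto simp: M_def)
      have e1: "e \<le> c r0" "e \<le> d y0" using eM by (auto simp: M_def)
      have sc: "sum c' B = sum c B - (if r0 \<in> B then e else 0)" if "finite B" for B
        using that by (auto simp: c'_def sum.remove intro!: sum.cong)
      have sd: "sum d' Z = sum d Z - (if y0 \<in> Z then e else 0)" if "finite Z" for Z
        using that by (auto simp: d'_def sum.remove intro!: sum.cong)
      have hall': "sum d' Z \<le> sum c' (nbrs E A Z)" if "Z \<subseteq> Y" for Z
      proof -
        have finZ: "finite Z" using that finY finite_subset by blast
        have base: "sum d Z \<le> sum c (nbrs E A Z)" using less.prems(5) that by blast
        show ?thesis
        proof (cases "y0 \<in> Z \<or> r0 \<notin> nbrs E A Z")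
          case True
          then show ?thesis using base \<open>0 \<le> e\<close> finZ finA by (auto simp: sc sd finite_nbrs)
        next
          case False
          then have "Z \<in> K" using that by (auto simp: K_def nbrs_def)
          then have "e \<le> slack Z" using eM by (simp add: M_def)
          then show ?thesis using False finZ finA by (simp add: sc sd finite_nbrs slack_def)
        qed
      qed
      have "(\<exists>y\<in>Y. d' y = 0) \<or> (\<exists>r\<in>A. c' r = 0) \<or>
          (\<exists>Z. Z \<subset> Y \<and> Z \<noteq> {} \<and> sum c' (nbrs E A Z) = sum d' Z)"
      proof -
        consider "e = c r0" | "e = d y0" | Z where "Z \<in> K" "e = slack Z"
          using \<open>e \<in> M\<close> by (auto simp: M_def)
        then show ?thesis
        proof cases
          case 1
          then show ?thesis using r0 by (auto simp: c'_def)
        next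
          case 2
          then show ?thesis using y0 by (auto simp: d'_def)
        next
          case 3
          then have "finite Z" "y0 \<notin> Z" "Z \<subset> Y" "Z \<noteq> {}" "r0 \<in> nbrs E A Z"
            using finY y0 by (auto simp: K_def intro: finite_subset)
          then have "sum c' (nbrs E A Z) = sum d' Z"
            using 3 finA by (simp add: sc sd finite_nbrs slack_def)
          then show ?thesis using \<open>Z \<subset> Y\<close> \<open>Z \<noteq> {}\<close> by blast
        qed
      qed
      then have "\<exists>g. transport E A Y c' d' g"
        using less.prems hall' e1 by (intro reducible) (auto simp: c'_def d'_def)
      then show ?thesis
        using transport_add_edge[of A Y r0 y0 E e c d] finA finY r0 y0 \<open>0 \<le> e\<close>
        unfolding c'_def d'_def by blast
    qed
  qed
qed

section \<open>Borda scores\<close>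

lemma finite_rankings: "finite C \<Longrightarrow> finite (rankings C)"
  by (rule finite_subset[of _ "Pow (C \<times> C)"]) (auto simp: rankings_def)

lemma rankings_irrefl: "r \<in> rankings C \<Longrightarrow> (x, x) \<notin> r"
  by (auto simp: rankings_def strict_linear_order_on_def irrefl_def)

lemma rankings_trans: "r \<in> rankings C \<Longrightarrow> (x, y) \<in> r \<Longrightarrow> (y, z) \<in> r \<Longrightarrow> (x, z) \<in> r"
  unfolding rankings_def strict_linear_order_on_def trans_def by blast

lemma rankings_total:
  "r \<in> rankings C \<Longrightarrow> x \<in> C \<Longrightarrow> y \<in> C \<Longrightarrow> x \<noteq> y \<Longrightarrow> (x, y) \<in> r \<longleftrightarrow> (y, x) \<notin> r"
  using rankings_irrefl[of r C x] rankings_trans[of r C x y x]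
  by (auto simp: rankings_def strict_linear_order_on_def total_on_def)

lemma u_cand_eq_sum:
  assumes "finite X" "r \<in> rankings C"
  shows "real (u_cand r x X) = (\<Sum>y\<in>X. of_bool ((x, y) \<in> r))"
proof -
  have "{y \<in> X - {x}. (x, y) \<in> r} = {y \<in> X. (x, y) \<in> r}"
    using rankings_irrefl[OF assms(2)] by auto
  then show ?thesis
    using assms by (simp add: u_cand_def of_bool_def sum.If_cases Collect_conj_eq Int_commute)
qed

text \<open>Two distinct members of \<open>X\<close> are compared in exactly one direction, so the
  double sum plus its transpose counts each ordered pair off the diagonal once.\<close>

lemma sum_u_cand:
  assumes "finite X" "X \<subseteq> C" "r \<in> rankings C"
  shows "(\<Sum>x\<in>X. real (u_cand r x X)) = real (card X) * (real (card X) - 1) / 2"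
proof -
  define s :: real where "s = (\<Sum>x\<in>X. \<Sum>y\<in>X. of_bool ((x, y) \<in> r))"
  have "s + s = (\<Sum>x\<in>X. \<Sum>y\<in>X. of_bool ((x, y) \<in> r)) + (\<Sum>x\<in>X. \<Sum>y\<in>X. of_bool ((y, x) \<in> r))"
    unfolding s_def by (subst (2) sum.swap) simp
  also have "\<dots> = (\<Sum>x\<in>X. \<Sum>y\<in>X. of_bool ((x, y) \<in> r) + of_bool ((y, x) \<in> r))"
    by (simp add: sum.distrib)
  also have "\<dots> = (\<Sum>x\<in>X. \<Sum>y\<in>X. 1 - of_bool (y = x))"
  proof (intro sum.cong refl)
    fix x y assume "x \<in> X" "y \<in> X"
    then show "of_bool ((x, y) \<in> r) + of_bool ((y, x) \<in> r) = (1 - of_bool (y = x) :: real)"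
      using rankings_total[OF assms(3), of x y] rankings_irrefl[OF assms(3), of x] assms(2)
      by (cases "x = y") auto
  qed
  also have "\<dots> = real (card X) * (real (card X) - 1)"
    using assms(1) by (simp add: sum_subtractf of_bool_def)
  finally show ?thesis
    using assms by (simp add: u_cand_eq_sum s_def)
qed

lemma u_cand_mono: "finite X \<Longrightarrow> Y \<subseteq> X \<Longrightarrow> u_cand r x Y \<le> u_cand r x X"
  unfolding u_cand_def by (intro card_mono) auto

text \<open>By transitivity \<open>y\<close> beats \<open>x\<close> and all that \<open>x\<close>
  beats. As \<open>x\<close> beats nobody in \<open>Y\<close>, these are disjoint from the members
  of \<open>Y\<close> that \<open>y\<close> beats.\<close>

lemma u_cand_above:
  assumes "finite X" "X \<subseteq> C" "r \<in> rankings C" "x \<in> X" "Y \<subseteq> X - {x}"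
    and above: "\<forall>y\<in>Y. (x, y) \<notin> r" and y: "y \<in> Y"
  shows "u_cand r y Y + 1 + u_cand r x X \<le> u_cand r y X"
proof -
  let ?A = "{z \<in> Y - {y}. (y, z) \<in> r}" and ?B = "{z \<in> X - {x}. (x, z) \<in> r}"
  have "finite Y" using assms by (meson finite_Diff finite_subset)
  then have fin: "finite ?A" "finite ?B" using assms by auto
  have yx: "(y, x) \<in> r"
    using rankings_total[OF assms(3), of x y] assms by blast
  have "u_cand r y Y + 1 + u_cand r x X = card ?A + card (insert x ?B)"
    using fin by (simp add: u_cand_def)
  also have "\<dots> = card (?A \<union> insert x ?B)"
    using fin assms by (subst card_Un_disjoint) auto
  also have "\<dots> \<le> u_cand r y X"
    unfolding u_cand_def
    using assms yx y rankings_irrefl[OF assms(3)] rankings_trans[OF assms(3) yx]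
    by (intro card_mono) auto
  finally show ?thesis .
qed

lemma u_cand_le_Diff:
  assumes "finite X" "x \<in> X" "Y \<subseteq> X - {x}" "\<forall>y\<in>Y. (x, y) \<notin> r"
  shows "real (u_cand r x X) \<le> real (card X) - 1 - real (card Y)"
proof -
  have "u_cand r x X \<le> card (X - {x} - Y)"
    unfolding u_cand_def using assms by (intro card_mono) auto
  moreover have "card (X - {x} - Y) = card X - 1 - card Y"
    using assms by (simp add: card_Diff_subset finite_subset)
  moreover have "card Y \<le> card X - 1"
    using assms card_mono[of "X - {x}" Y] by simp
  moreover have "card X \<ge> 1" using assms card_gt_0_iff[of X] by (auto simp: Suc_le_eq)
  ultimately show ?thesis by linarith
qed

lemma u_cand_le: "finite X \<Longrightarrow> x \<in> X \<Longrightarrow> real (u_cand r x X) \<le> real (card X) - 1"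
  using u_cand_le_Diff[of X x "{}"] by simp

section \<open>Score bounds for the Borda winner of one round\<close>

locale borda_round =
  fixes C :: "'a set" and b :: "'a rel \<Rightarrow> real" and X :: "'a set" and x :: 'a
  assumes finC: "finite C" and XC: "X \<subseteq> C" and xX: "x \<in> X"
    and budget_nonneg: "\<And>r. r \<in> rankings C \<Longrightarrow> 0 \<le> b r"
    and score_max: "\<And>y. y \<in> X \<Longrightarrow> U_score C b y X \<le> U_score C b x X"
    and rankings_nonempty: "rankings C \<noteq> {}"
begin

abbreviation u :: "'a rel \<Rightarrow> real" where "u r \<equiv> real (u_cand r x X)"
abbreviation total :: real where "total \<equiv> (\<Sum>r\<in>rankings C. b r)"
abbreviation k :: real where "k \<equiv> real (card X)"
abbreviation supporters :: "'a set \<Rightarrow> 'a rel set" where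
  "supporters \<equiv> nbrs (\<lambda>r y. (x, y) \<in> r) (rankings C)"

lemma finX: "finite X"
  using finC XC finite_subset by blast

lemma finR: "finite (rankings C)"
  using finC by (rule finite_rankings)

lemma supporters_sub: "supporters Y \<subseteq> rankings C"
  by (auto simp: nbrs_def)

lemma split_supporters:
  "sum h (rankings C) = sum h (rankings C - supporters Y) + sum h (supporters Y)"
  for h :: "'a rel \<Rightarrow> real"
  by (rule sum.subset_diff[OF supporters_sub finR])

lemma score_sum:
  "(\<Sum>y\<in>Y. U_score C b y X) = (\<Sum>r\<in>rankings C. b r * (\<Sum>y\<in>Y. real (u_cand r y X)))"
  unfolding U_score_def by (subst sum.swap) (simp add: sum_distrib_left)

text \<open>A maximal score is at least the average score, and every ranking hands out
  \<open>k * (k - 1) / 2\<close> points among the \<open>k\<close> remaining candidates.\<close>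

lemma score_ge_average: "total * (k - 1) / 2 \<le> (\<Sum>r\<in>rankings C. b r * u r)"
proof -
  have "k * (total * (k - 1) / 2) = (\<Sum>r\<in>rankings C. b r * (k * (k - 1) / 2))"
    unfolding sum_distrib_right[symmetric] by simp
  also have "\<dots> = (\<Sum>y\<in>X. U_score C b y X)"
    unfolding score_sum by (intro sum.cong refl arg_cong2[where f = "(*)"] sum_u_cand[OF finX XC, symmetric])
  also have "\<dots> \<le> k * U_score C b x X"
    using score_max by (intro sum_bounded_above) auto
  finally show ?thesis
    using xX finX card_gt_0_iff[of X]
    by (simp only: U_score_def mult_le_cancel_left_pos[of k] of_nat_0_less_iff) auto
qed

text \<open>
  Compare the score of x with the average score of Y: a ranking that puts all of Y above x gives
  the members of Y in total at least j (j + 1) / 2 points more than j copies of x, where j is the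
  size of Y, and every other ranking gives them at least j (j - 1) / 2 points.
\<close>
lemma supporters_score:
  assumes Y: "Y \<subseteq> X - {x}" "Y \<noteq> {}"
  shows "total * (real (card Y) + 1) / 2 - sum b (supporters Y)
           \<le> (\<Sum>r\<in>supporters Y. b r * u r)"
proof -
  define j where "j = real (card Y)"
  have finY: "finite Y" using Y finX finite_subset by blast
  have jpos: "0 < j" using Y finY by (simp add: j_def card_gt_0_iff)
  define D where "D r = (\<Sum>y\<in>Y. real (u_cand r y X))" for r
  have YC: "Y \<subseteq> C" using Y XC by blast
  have in_D: "j * (j - 1) / 2 \<le> D r" if "r \<in> rankings C" for r
  proof -
    have "(\<Sum>y\<in>Y. real (u_cand r y Y)) \<le> D r"
      unfolding D_def using Y finX by (intro sum_mono) (auto intro: u_cand_mono)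
    then show ?thesis using sum_u_cand[OF finY YC that] by (simp add: j_def)
  qed
  have out_D: "j * (j - 1) / 2 + j + j * u r \<le> D r" if "r \<in> rankings C - supporters Y" for r
  proof -
    have "(\<Sum>y\<in>Y. real (u_cand r y Y) + 1 + u r) \<le> D r"
      unfolding D_def
    proof (intro sum_mono)
      fix y assume "y \<in> Y"
      then have "u_cand r y Y + 1 + u_cand r x X \<le> u_cand r y X"
        using that Y finX XC xX by (intro u_cand_above) (auto simp: nbrs_def)
      then show "real (u_cand r y Y) + 1 + u r \<le> real (u_cand r y X)" by linarith
    qed
    then show ?thesis using sum_u_cand[OF finY YC, of r] that by (simp add: sum.distrib j_def)
  qed
  have "(\<Sum>r\<in>rankings C - supporters Y. b r * (j * (j - 1) / 2 + j + j * u r))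
      + (\<Sum>r\<in>supporters Y. b r * (j * (j - 1) / 2)) \<le> (\<Sum>r\<in>rankings C. b r * D r)"
    unfolding split_supporters[of _ Y]
    using in_D out_D budget_nonneg supporters_sub[of Y]
    by (intro add_mono sum_mono mult_left_mono) auto
  also have "\<dots> = (\<Sum>y\<in>Y. U_score C b y X)" by (simp add: score_sum D_def)
  also have "\<dots> \<le> j * U_score C b x X"
    unfolding j_def using score_max Y by (intro sum_bounded_above) auto
  also have "U_score C b x X = (\<Sum>r\<in>rankings C - supporters Y. b r * u r)
      + (\<Sum>r\<in>supporters Y. b r * u r)"
    unfolding U_score_def by (rule split_supporters)
  also have "(\<Sum>r\<in>rankings C - supporters Y. b r * (j * (j - 1) / 2 + j + j * u r))
      = sum b (rankings C - supporters Y) * (j * (j - 1) / 2 + j)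
        + j * (\<Sum>r\<in>rankings C - supporters Y. b r * u r)"
    by (simp add: sum.distrib sum_distrib_left sum_distrib_right algebra_simps)
  also have "(\<Sum>r\<in>supporters Y. b r * (j * (j - 1) / 2)) = sum b (supporters Y) * (j * (j - 1) / 2)"
    by (simp add: sum_distrib_right)
  \<comment> \<open>The points that non-supporters give to \<open>x\<close> occur on both sides with
    factor \<open>j\<close> and cancel.\<close>
  finally have "j * (sum b (rankings C - supporters Y) * ((j - 1) / 2 + 1)
      + sum b (supporters Y) * ((j - 1) / 2)) \<le> j * (\<Sum>r\<in>supporters Y. b r * u r)"
    by (simp add: algebra_simps)
  then have "sum b (rankings C - supporters Y) * ((j - 1) / 2 + 1)
      + sum b (supporters Y) * ((j - 1) / 2) \<le> (\<Sum>r\<in>supporters Y. b r * u r)"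
    using jpos by simp
  moreover have "sum b (rankings C - supporters Y) = total - sum b (supporters Y)"
    using split_supporters[of b Y] by linarith
  moreover have "(t - w) * ((j - 1) / 2 + 1) + w * ((j - 1) / 2) = t * (j + 1) / 2 - w" for t w
    by (simp add: field_simps)
  ultimately show ?thesis unfolding j_def by (simp only:)
qed

text \<open>
  If supporters of x against Y hold at most half of the budget, this is the previous bound;
  otherwise the non-supporters, who rank x below all of Y, contribute too little to the score of x.
\<close>
lemma supporters_score_ge:
  assumes Y: "Y \<subseteq> X - {x}"
  shows "real (card Y) * total / 2 \<le> (\<Sum>r\<in>supporters Y. b r * u r)"
proof (cases "Y = {}")
  case True
  then show ?thesis by (simp add: nbrs_def)
next
  case False
  define w where "w = sum b (supporters Y)"
  define j where "j = real (card Y)"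
  show ?thesis
  proof (cases "w \<le> total / 2")
    case True
    then show ?thesis using supporters_score[OF Y False] by (simp add: w_def field_simps)
  next
    case w: False
    have "(\<Sum>r\<in>rankings C - supporters Y. b r * u r)
        \<le> (\<Sum>r\<in>rankings C - supporters Y. b r * (k - 1 - j))"
      unfolding j_def using budget_nonneg Y finX xX
      by (intro sum_mono mult_left_mono u_cand_le_Diff) (auto simp: nbrs_def)
    also have "\<dots> = (total - w) * (k - 1 - j)"
      using split_supporters[of b Y] by (simp add: w_def sum_distrib_right[symmetric])
    also have "\<dots> \<le> total / 2 * (k - 1 - j)"
    proof (rule mult_right_mono)
      have "card Y \<le> card (X - {x})" using finX Y by (intro card_mono) auto
      then have "Suc (card Y) \<le> card X" using card_Suc_Diff1[OF finX xX] by simp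
      then show "0 \<le> k - 1 - j" unfolding j_def by linarith
    qed (use w in simp)
    finally have "total * (k - 1) / 2 - total / 2 * (k - 1 - j) \<le> (\<Sum>r\<in>supporters Y. b r * u r)"
      using score_ge_average split_supporters[of "\<lambda>r. b r * u r" Y] by linarith
    moreover have "total * (k - 1) / 2 - total / 2 * (k - 1 - j) = j * total / 2"
      by (simp add: field_simps)
    ultimately show ?thesis unfolding j_def by linarith
  qed
qed

text \<open>A supporter gives \<open>x\<close> at most \<open>k - 1\<close> points, which turns the
  score bound of \<open>supporters_score\<close> into a bound on budget. This is the form of Hall's
  condition used when three candidates are left.\<close>

lemma supporters_weight_ge:
  assumes Y: "Y \<subseteq> X - {x}" "Y \<noteq> {}"
  shows "total * (real (card Y) + 1) / 2 \<le> k * sum b (supporters Y)"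
proof -
  have "(\<Sum>r\<in>supporters Y. b r * u r) \<le> (\<Sum>r\<in>supporters Y. b r * (k - 1))"
    using budget_nonneg supporters_sub[of Y] finX xX
    by (intro sum_mono mult_left_mono u_cand_le) auto
  also have "\<dots> = (k - 1) * sum b (supporters Y)"
    by (simp add: sum_distrib_left mult.commute)
  finally show ?thesis using supporters_score[OF Y] by (simp add: algebra_simps)
qed

subsection \<open>Flows in one round\<close>

lemma flow_value_swap: "flow_value C X x g = (\<Sum>y\<in>X - {x}. \<Sum>r\<in>rankings C. g r y)"
  unfolding flow_value_def src_flow_def by (rule sum.swap)

lemma card_rest: "real (card (X - {x})) = k - 1"
  using card_Suc_Diff1[OF finX xX] by linarith

lemma flow_value_le:
  assumes "is_flow C b X x g"
  shows "flow_value C X x g \<le> k - 1"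
proof -
  have "flow_value C X x g \<le> (\<Sum>y\<in>X - {x}. 1)"
    unfolding flow_value_swap using assms by (intro sum_mono) (auto simp: is_flow_def)
  then show ?thesis using card_rest by simp
qed

text \<open>With \<open>u r = 0\<close> no edge leaves the vertex of \<open>r\<close>. The third
  claim handles rankings whose ratio in \<open>max_ratio\<close> has denominator zero.\<close>

lemma src_flow_bounds:
  assumes "is_flow C b X x g" "r \<in> rankings C"
  shows "0 \<le> src_flow X x g r" "src_flow X x g r \<le> b r" "u r = 0 \<Longrightarrow> src_flow X x g r = 0"
proof -
  show "0 \<le> src_flow X x g r" "src_flow X x g r \<le> b r"
    using assms by (auto simp: is_flow_def src_flow_def intro!: sum_nonneg)
  show "src_flow X x g r = 0" if "u r = 0"
  proof -
    have "{y \<in> X - {x}. (x, y) \<in> r} = {}"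
      using that finX by (simp add: u_cand_def)
    then show ?thesis
      using assms unfolding src_flow_def is_flow_def by (intro sum.neutral) blast
  qed
qed

text \<open>An instance of \<open>fractional_hall\<close> with artificial supplies \<open>c\<close>
  below the budgets, which cap what each ranking pays, and a uniform demand \<open>d\<close>, which
  may be below the sink capacity when saturation is impossible.\<close>

lemma flow_of_supply:
  assumes "\<And>r. r \<in> rankings C \<Longrightarrow> 0 \<le> c r" "\<And>r. r \<in> rankings C \<Longrightarrow> c r \<le> b r"
    and "0 \<le> d" "d \<le> 1"
    and "\<And>Y. Y \<subseteq> X - {x} \<Longrightarrow> real (card Y) * d \<le> sum c (supporters Y)"
  shows "\<exists>g. is_flow C b X x g \<and> flow_value C X x g = (k - 1) * d \<and>
    (\<forall>r\<in>rankings C. src_flow X x g r \<le> c r)"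
proof -
  have "\<exists>g. transport (\<lambda>r y. (x, y) \<in> r) (rankings C) (X - {x}) c (\<lambda>_. d) g"
    using assms finR finX by (intro fractional_hall) auto
  then obtain g where g: "transport (\<lambda>r y. (x, y) \<in> r) (rankings C) (X - {x}) c (\<lambda>_. d) g"
    by blast
  have src: "src_flow X x g r \<le> c r" if "r \<in> rankings C" for r
    using g that by (simp add: transport_def src_flow_def)
  have "is_flow C b X x g"
    using g assms(2,4) src unfolding is_flow_def transport_def by fastforce
  moreover have "flow_value C X x g = (k - 1) * d"
    using g card_rest by (simp add: flow_value_swap transport_def)
  ultimately show ?thesis using src by blast
qed

lemma chosen_flow_large_round:
  assumes "4 \<le> card X" and total: "total = k * (k - 1) / 2" and f: "is_chosen_flow C b X x f"
  shows "flow_value C X x f = k - 1"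
    and "\<And>r. r \<in> rankings C \<Longrightarrow> src_flow X x f r \<le> 2 / total * (b r * u r)"
proof -
  have k4: "4 \<le> k" using assms(1) by simp
  have pos: "0 < total" unfolding total using k4 by simp
  \<comment> \<open>The supplies respect the budgets: \<open>u r\<close> is at most
    \<open>k - 1\<close>, and \<open>2 / total * (k - 1)\<close> equals \<open>4 / k\<close>. This
    is where four remaining candidates are needed.\<close>
  have "2 / total * (b r * u r) \<le> b r" if "r \<in> rankings C" for r
  proof -
    have "2 / total * u r \<le> 2 / total * (k - 1)"
      using pos u_cand_le[OF finX xX] by (intro mult_left_mono) auto
    also have "\<dots> = 4 / k" unfolding total using k4 by (simp add: divide_simps)
    also have "\<dots> \<le> 1" using k4 by (simp add: divide_simps)
    finally have "b r * (2 / total * u r) \<le> b r * 1"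
      by (intro mult_left_mono budget_nonneg that)
    then show ?thesis by (simp add: mult_ac)
  qed
  moreover have "real (card Y) * 1 \<le> (\<Sum>r\<in>supporters Y. 2 / total * (b r * u r))"
    if "Y \<subseteq> X - {x}" for Y
  proof -
    have "2 / total * (real (card Y) * total / 2) \<le> 2 / total * (\<Sum>r\<in>supporters Y. b r * u r)"
      using pos supporters_score_ge[OF that] by (intro mult_left_mono) auto
    moreover have "2 / total * (real (card Y) * total / 2) = real (card Y) * 1" using pos by simp
    ultimately show ?thesis unfolding sum_distrib_left[symmetric] by (simp only:)
  qed
  moreover have "0 \<le> 2 / total * (b r * u r)" if "r \<in> rankings C" for r
    using pos budget_nonneg[OF that] by simp
  ultimately have "\<exists>g. is_flow C b X x g \<and> flow_value C X x g = (k - 1) * 1 \<and>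
      (\<forall>r\<in>rankings C. src_flow X x g r \<le> 2 / total * (b r * u r))"
    by (intro flow_of_supply) simp_all
  then obtain g where g: "is_flow C b X x g" "flow_value C X x g = (k - 1) * 1"
    and src: "\<And>r. r \<in> rankings C \<Longrightarrow> src_flow X x g r \<le> 2 / total * (b r * u r)"
    by blast
  \<comment> \<open>\<open>g\<close> saturates all sink edges and is therefore maximum, so the
    chosen flow competes with it and inherits its bound on the ratios.\<close>
  have gmax: "is_max_flow C b X x g" using g flow_value_le by (simp add: is_max_flow_def)
  have fflow: "is_flow C b X x f" using f by (simp add: is_chosen_flow_def is_max_flow_def)
  show "flow_value C X x f = k - 1"
    using f g flow_value_le[OF fflow] by (force simp: is_chosen_flow_def is_max_flow_def)
  have "max_ratio C b X x f \<le> max_ratio C b X x g" using f gmax by (simp add: is_chosen_flow_def)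
  also have "\<dots> \<le> 2 / total"
  proof -
    have "src_flow X x g r / (b r * u r) \<le> 2 / total" if "r \<in> rankings C" for r
    proof (cases "b r * u r = 0")
      case True
      then show ?thesis using pos by auto
    next
      case False
      then have "0 < b r * u r"
        using mult_nonneg_nonneg[OF budget_nonneg[OF that] of_nat_0_le_iff]
        by (metis order.not_eq_order_implies_strict)
      then show ?thesis using src[OF that] by (simp only: pos_divide_le_eq)
    qed
    then show ?thesis unfolding max_ratio_def using finR rankings_nonempty by simp
  qed
  finally have ratio: "max_ratio C b X x f \<le> 2 / total" .
  fix r assume r: "r \<in> rankings C"
  show "src_flow X x f r \<le> 2 / total * (b r * u r)"
  proof (cases "b r * u r = 0")
    case True
    \<comment> \<open>Here the ratio is 0 by convention and says nothing, but a ranking without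
      budget or without an outgoing edge pays nothing.\<close>
    then have "src_flow X x f r = 0"
      using src_flow_bounds[OF fflow r] by auto
    then show ?thesis using True by auto
  next
    case False
    then have pos_bu: "0 < b r * u r"
      using mult_nonneg_nonneg[OF budget_nonneg[OF r] of_nat_0_le_iff]
      by (metis order.not_eq_order_implies_strict)
    have "src_flow X x f r / (b r * u r) \<le> max_ratio C b X x f"
      unfolding max_ratio_def using finR r by (intro Max_ge) auto
    also note ratio
    finally show ?thesis using pos_bu by (simp only: pos_divide_le_eq)
  qed
qed

text \<open>With \<open>k\<close> and \<open>total\<close> both 3, the supporters of
  \<open>j\<close> candidates hold at least \<open>(j + 1) / 2\<close>. For \<open>j = 1\<close> and
  \<open>j = 2\<close> this covers \<open>3 / 4\<close> per candidate, tightly for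
  \<open>j = 2\<close>, so a flow of \<open>3 / 4\<close> into each of the two sink edges
  exists.\<close>

lemma max_flow_three_left:
  assumes "card X = 3" "total = 3" and f: "is_max_flow C b X x f"
  shows "3 / 2 \<le> flow_value C X x f"
proof -
  have "real (card Y) * (3 / 4) \<le> sum b (supporters Y)" if Y: "Y \<subseteq> X - {x}" for Y
  proof (cases "Y = {}")
    case True
    then show ?thesis by (simp add: nbrs_def)
  next
    case False
    have "real (card Y) \<le> 2"
      using card_mono[OF _ Y] finX xX assms by (simp add: card_Diff_singleton)
    then show ?thesis using supporters_weight_ge[OF Y False] assms by simp
  qed
  then have "\<exists>g. is_flow C b X x g \<and> flow_value C X x g = (k - 1) * (3 / 4) \<and>
      (\<forall>r\<in>rankings C. src_flow X x g r \<le> b r)"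
    using budget_nonneg by (intro flow_of_supply) simp_all
  then obtain g where "is_flow C b X x g" "flow_value C X x g = (k - 1) * (3 / 4)" by blast
  then show ?thesis using f assms by (force simp: is_max_flow_def)
qed

section \<open>Utility of a group holding a share of each ranking's budget\<close>

context
  fixes \<alpha> :: "'a rel \<Rightarrow> real"
  assumes \<alpha>: "\<And>r. r \<in> rankings C \<Longrightarrow> 0 \<le> \<alpha> r \<and> \<alpha> r \<le> 1"
begin

text \<open>By the ratio bound, a payment \<open>p\<close> of the group is matched by at least
  \<open>p * total / 2\<close> points, hence by \<open>p * q / 2\<close> as
  \<open>q \<le> total\<close>. This dominates the drop of the potential \<open>q^2 / 4\<close> to
  \<open>(q - p)^2 / 4\<close>, so the rounds telescope.\<close>

lemma group_utility_large_round:
  assumes "4 \<le> card X" and total: "total = k * (k - 1) / 2" and f: "is_chosen_flow C b X x f"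
  shows "((\<Sum>r\<in>rankings C. \<alpha> r * b r)\<^sup>2 - (\<Sum>r\<in>rankings C. \<alpha> r * (b r - src_flow X x f r))\<^sup>2) / 4
     \<le> (\<Sum>r\<in>rankings C. \<alpha> r * b r * u r)"
proof -
  define q where "q = (\<Sum>r\<in>rankings C. \<alpha> r * b r)"
  define p where "p = (\<Sum>r\<in>rankings C. \<alpha> r * src_flow X x f r)"
  have fflow: "is_flow C b X x f" using f by (simp add: is_chosen_flow_def is_max_flow_def)
  have k4: "4 \<le> k" using assms(1) by simp
  have pos: "0 < total" unfolding total using k4 by simp
  have q': "(\<Sum>r\<in>rankings C. \<alpha> r * (b r - src_flow X x f r)) = q - p"
    by (simp add: q_def p_def right_diff_distrib sum_subtractf)
  have "p \<le> (\<Sum>r\<in>rankings C. \<alpha> r * (2 / total * (b r * u r)))"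
    unfolding p_def using chosen_flow_large_round(2)[OF assms] \<alpha>
    by (intro sum_mono mult_left_mono) auto
  also have "\<dots> = 2 / total * (\<Sum>r\<in>rankings C. \<alpha> r * b r * u r)"
    by (simp add: sum_distrib_left mult_ac)
  finally have score: "p * total / 2 \<le> (\<Sum>r\<in>rankings C. \<alpha> r * b r * u r)"
    using pos by (simp add: field_simps)
  have "0 \<le> p"
    unfolding p_def using src_flow_bounds[OF fflow] \<alpha> by (intro sum_nonneg mult_nonneg_nonneg) auto
  have "(q\<^sup>2 - (q - p)\<^sup>2) / 4 = p * q / 2 - p\<^sup>2 / 4"
    by (simp add: power2_eq_square field_simps)
  also have "\<dots> \<le> p * q / 2" by simp
  also have "\<dots> \<le> p * total / 2"
  proof -
    have "q \<le> total"
      unfolding q_def using \<alpha> budget_nonneg by (intro sum_mono mult_left_le_one_le) auto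
    then show ?thesis using \<open>0 \<le> p\<close> by (simp add: mult_left_mono)
  qed
  also note score
  finally show ?thesis unfolding q' q_def[symmetric] .
qed

text \<open>A ranking pays at most its budget, and only if it gives \<open>x\<close> at least one
  point. This holds for every flow, so it serves the round with three candidates left, where no
  ratio bound is at hand.\<close>

lemma group_utility_ge_payment:
  assumes f: "is_flow C b X x f"
  shows "(\<Sum>r\<in>rankings C. \<alpha> r * b r) - (\<Sum>r\<in>rankings C. \<alpha> r * (b r - src_flow X x f r))
     \<le> (\<Sum>r\<in>rankings C. \<alpha> r * b r * u r)"
proof -
  have "\<alpha> r * src_flow X x f r \<le> \<alpha> r * (b r * u r)" if r: "r \<in> rankings C" for r
  proof (intro mult_left_mono)
    show "src_flow X x f r \<le> b r * u r"
    proof (cases "u r = 0")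
      case True
      then show ?thesis using src_flow_bounds(3)[OF f r] by simp
    next
      case False
      then have "b r * 1 \<le> b r * u r" using budget_nonneg[OF r] by (intro mult_left_mono) auto
      then show ?thesis using src_flow_bounds(2)[OF f r] by simp
    qed
  qed (use \<alpha> r in auto)
  then have "(\<Sum>r\<in>rankings C. \<alpha> r * src_flow X x f r) \<le> (\<Sum>r\<in>rankings C. \<alpha> r * b r * u r)"
    by (intro sum_mono) (simp add: mult.assoc)
  then show ?thesis by (simp add: right_diff_distrib sum_subtractf)
qed

text \<open>The winner is supported by at least half of the budget, and voters outside the group can
  provide at most their own budget of that support.\<close>

lemma group_utility_two_left:
  assumes "card X = 2"
  shows "(\<Sum>r\<in>rankings C. \<alpha> r * b r) - total / 2 \<le> (\<Sum>r\<in>rankings C. \<alpha> r * b r * u r)"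
proof -
  have "(\<Sum>r\<in>rankings C. (1 - \<alpha> r) * b r * u r) \<le> (\<Sum>r\<in>rankings C. (1 - \<alpha> r) * b r * 1)"
    using \<alpha> budget_nonneg u_cand_le[OF finX xX] assms
    by (intro sum_mono mult_left_mono mult_nonneg_nonneg) auto
  then have "(\<Sum>r\<in>rankings C. b r * u r) - (\<Sum>r\<in>rankings C. \<alpha> r * b r * u r)
      \<le> total - (\<Sum>r\<in>rankings C. \<alpha> r * b r)"
    by (simp add: left_diff_distrib sum_subtractf)
  then show ?thesis using score_ge_average assms by simp
qed

end

end

section \<open>Runs of the rule\<close>

lemma set_Diff_take: "distinct xs \<Longrightarrow> set xs - set (take i xs) = set (drop i xs)"
  using set_take_disj_set_drop_if_distinct[of xs i i] set_append[of "take i xs" "drop i xs"] by auto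

text \<open>A pair on which the rankings agree is counted in the round that picks its upper member,
  when the lower one still remains.\<close>

lemma u_pair_ranking_of:
  assumes "distinct xs"
  shows "u_pair r (ranking_of xs) = (\<Sum>i<length xs. u_cand r (xs ! i) (set xs - set (take i xs)))"
proof -
  define T where "T i = {y \<in> set xs - set (take i xs) - {xs ! i}. (xs ! i, y) \<in> r}" for i
  have rest: "set xs - set (take i xs) - {xs ! i} = set (drop (Suc i) xs)" if "i < length xs" for i
  proof -
    have "set xs - set (take i xs) - {xs ! i} = set xs - set (take (Suc i) xs)"
      using that by (auto simp: take_Suc_conv_app_nth)
    then show ?thesis using set_Diff_take[OF assms] by simp
  qed
  have "{(x, y). (x, y) \<in> r \<and> (x, y) \<in> ranking_of xs} = (\<lambda>(i, y). (xs ! i, y)) ` Sigma {..<length xs} T"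
  proof (intro equalityI subsetI)
    fix p assume "p \<in> {(x, y). (x, y) \<in> r \<and> (x, y) \<in> ranking_of xs}"
    then obtain i j where ij: "p = (xs ! i, xs ! j)" "i < j" "j < length xs" "(xs ! i, xs ! j) \<in> r"
      by (auto simp: ranking_of_def)
    have "xs ! j \<in> set (drop (Suc i) xs)"
      using ij by (auto simp: in_set_conv_nth intro!: exI[of _ "j - Suc i"])
    then have "xs ! j \<in> T i" using rest[of i] ij by (auto simp: T_def)
    then show "p \<in> (\<lambda>(i, y). (xs ! i, y)) ` Sigma {..<length xs} T"
      using ij by (auto intro!: image_eqI[of _ _ "(i, xs ! j)"])
  next
    fix p assume "p \<in> (\<lambda>(i, y). (xs ! i, y)) ` Sigma {..<length xs} T"
    then obtain i y where iy: "p = (xs ! i, y)" "i < length xs" "y \<in> T i" by auto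
    then have "y \<in> set (drop (Suc i) xs)" "(xs ! i, y) \<in> r" using rest[of i] by (auto simp: T_def)
    then obtain l where "l < length xs - Suc i" "y = xs ! (Suc i + l)"
      by (auto simp: in_set_conv_nth)
    then have "\<exists>j. i < j \<and> j < length xs \<and> y = xs ! j" by (intro exI[of _ "Suc i + l"]) auto
    then show "p \<in> {(x, y). (x, y) \<in> r \<and> (x, y) \<in> ranking_of xs}"
      using iy \<open>(xs ! i, y) \<in> r\<close> by (auto simp: ranking_of_def)
  qed
  moreover have "inj_on (\<lambda>(i, y). (xs ! i, y)) (Sigma {..<length xs} T)"
    using assms by (auto simp: inj_on_def nth_eq_iff_index_eq)
  ultimately have "u_pair r (ranking_of xs) = card (Sigma {..<length xs} T)"
    by (simp add: u_pair_def card_image)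
  also have "\<dots> = (\<Sum>i<length xs. card (T i))"
    by (rule card_SigmaI) (auto simp: T_def)
  finally show ?thesis by (simp add: T_def u_cand_def)
qed

lemma real_choose_two: "real (n choose 2) = real n * (real n - 1) / 2"
proof -
  have "even (n * (n - 1))" by (cases n) auto
  then have "2 * (n choose 2) = n * (n - 1)" unfolding choose_two by (rule dvd_mult_div_cancel)
  then have "2 * real (n choose 2) = real n * real (n - 1)"
    by (metis of_nat_mult of_nat_numeral)
  then show ?thesis by (cases n) auto
qed

text \<open>The left side is \<open>t * (t - 3 / 4) / 4\<close>: nonpositive up to
  \<open>3 / 4\<close>, and beyond that at most \<open>t - 3 / 4\<close> because
  \<open>t \<le> 4\<close>. The slope \<open>3 / 16\<close> makes it vanish at
  \<open>t = 3 / 4\<close>, the kink of the linear guarantee.\<close>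

lemma final_rounds_bound:
  fixes t v :: real
  assumes "0 \<le> t" "t \<le> 3" "0 \<le> v" "t - 3 / 4 \<le> v"
  shows "t\<^sup>2 / 4 - 3 / 16 * t \<le> v"
proof (cases "t \<le> 3 / 4")
  case True
  then have "t * (t - 3 / 4) \<le> 0" using assms by (intro mult_nonneg_nonpos) auto
  then show ?thesis using assms by (simp add: power2_eq_square algebra_simps)
next
  case False
  then have "t * (t - 3 / 4) \<le> 4 * (t - 3 / 4)" using assms by (intro mult_right_mono) auto
  then show ?thesis using assms by (simp add: power2_eq_square algebra_simps)
qed

section \<open>Budgets of a subprofile along a run\<close>

locale fab_subprofile =
  fixes C :: "'a set" and R S :: "'a rel \<Rightarrow> real"
    and xs :: "'a list" and b :: "nat \<Rightarrow> 'a rel \<Rightarrow> real"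
  assumes finC: "finite C" and profile: "is_profile C R" and run: "FAB_run C R xs b"
    and sub: "\<forall>r\<in>rankings C. 0 \<le> S r \<and> S r \<le> R r"
begin

abbreviation left :: "nat \<Rightarrow> 'a set" where "left i \<equiv> C - set (take i xs)"

definition N :: real where "N = real (card C choose 2)"
text \<open>
  The fraction of the voters with ranking r that belongs to S; it is 0 where R r = 0, which is
  harmless because then S r = 0 as well.
\<close>
definition \<alpha> :: "'a rel \<Rightarrow> real" where "\<alpha> r = S r / R r"
definition B :: "nat \<Rightarrow> real" where "B i = (\<Sum>r\<in>rankings C. b i r)"
definition q :: "nat \<Rightarrow> real" where "q i = (\<Sum>r\<in>rankings C. \<alpha> r * b i r)"
definition V :: "nat \<Rightarrow> real" where
  "V i = (\<Sum>r\<in>rankings C. S r * real (u_cand r (xs ! i) (left i)))"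

lemma xs: "distinct xs" "set xs = C" "length xs = card C"
  using run distinct_card[of xs] by (auto simp: FAB_run_def)

lemma card_left: "card (left i) = card C - i"
  using set_Diff_take[OF xs(1), of i] xs distinct_card[of "drop i xs"] by simp

lemma \<alpha>_bounds: "r \<in> rankings C \<Longrightarrow> 0 \<le> \<alpha> r \<and> \<alpha> r \<le> 1"
  using sub by (auto simp: \<alpha>_def divide_le_eq_1 intro: order_trans)

lemma N_nonneg: "0 \<le> N"
  by (simp add: N_def)

lemma R_nonneg: "r \<in> rankings C \<Longrightarrow> 0 \<le> R r"
  using profile by (simp add: is_profile_def)

lemma b_0: "r \<in> rankings C \<Longrightarrow> b 0 r = R r * N"
  using run by (simp add: FAB_run_def N_def)

lemma \<alpha>_b_0: "r \<in> rankings C \<Longrightarrow> \<alpha> r * b 0 r = S r * N"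
  using sub by (cases "R r = 0") (auto simp: b_0 \<alpha>_def intro: antisym)

lemma chosen_flow:
  assumes "i < card C"
  obtains f where "is_chosen_flow C (b i) (left i) (xs ! i) f"
    "\<And>r. r \<in> rankings C \<Longrightarrow> b (Suc i) r = b i r - src_flow (left i) (xs ! i) f r"
proof -
  have "\<exists>f. is_chosen_flow C (b i) (left i) (xs ! i) f \<and>
      (\<forall>r\<in>rankings C. b (Suc i) r = b i r - src_flow (left i) (xs ! i) f r)"
    using run assms xs(3) by (simp add: FAB_run_def)
  then show ?thesis using that by blast
qed

text \<open>Nonnegativity of the budgets is a premise because \<open>budget_bounds\<close> applies
  this rule inside its own induction.\<close>

lemma borda_roundI:
  assumes "i < card C" "\<And>r. r \<in> rankings C \<Longrightarrow> 0 \<le> b i r"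
  shows "borda_round C (b i) (left i) (xs ! i)"
proof
  show "xs ! i \<in> left i"
    using set_Diff_take[OF xs(1), of i] xs assms Cons_nth_drop_Suc[of i xs]
    by (metis list.set_intros(1))
  show "rankings C \<noteq> {}" using profile by (auto simp: is_profile_def)
  show "U_score C (b i) y (left i) \<le> U_score C (b i) (xs ! i) (left i)" if "y \<in> left i" for y
    using run assms that xs by (auto simp: FAB_run_def)
qed (use assms finC in auto)

lemma budget_bounds:
  assumes "i \<le> card C" "r \<in> rankings C"
  shows "0 \<le> b i r \<and> b i r \<le> b 0 r"
  using assms
proof (induction i arbitrary: r)
  case 0
  then show ?case using R_nonneg N_nonneg by (simp add: b_0)
next
  case (Suc i)
  then interpret borda_round C "b i" "left i" "xs ! i" by (intro borda_roundI) auto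
  obtain f where f: "is_chosen_flow C (b i) (left i) (xs ! i) f"
    and "\<And>r. r \<in> rankings C \<Longrightarrow> b (Suc i) r = b i r - src_flow (left i) (xs ! i) f r"
    using chosen_flow[of i] Suc.prems by auto
  then show ?case
    using src_flow_bounds[of f r] Suc.IH[of r] Suc.prems
    by (simp add: is_chosen_flow_def is_max_flow_def)
qed

lemma borda_round_at: "i < card C \<Longrightarrow> borda_round C (b i) (left i) (xs ! i)"
  using budget_bounds[of i] by (intro borda_roundI) auto

lemma B_Suc:
  assumes "\<And>r. r \<in> rankings C \<Longrightarrow> b (Suc i) r = b i r - src_flow (left i) (xs ! i) f r"
  shows "B (Suc i) = B i - flow_value C (left i) (xs ! i) f"
  using assms by (simp add: B_def flow_value_def sum_subtractf)

lemma q_Suc: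
  assumes "\<And>r. r \<in> rankings C \<Longrightarrow> b (Suc i) r = b i r - src_flow (left i) (xs ! i) f r"
  shows "q (Suc i) = (\<Sum>r\<in>rankings C. \<alpha> r * (b i r - src_flow (left i) (xs ! i) f r))"
  using assms by (simp add: q_def)

text \<open>A round with \<open>k \<ge> 4\<close> candidates spends exactly \<open>k - 1\<close>,
  the difference between \<open>k\<close> choose 2 and \<open>k - 1\<close> choose 2. The last such
  round has four candidates, so the invariant still holds with three left.\<close>

lemma B_eq:
  assumes "i + 3 \<le> card C"
  shows "B i = real (card (left i)) * (real (card (left i)) - 1) / 2"
  using assms
proof (induction i)
  case 0
  have "B 0 = N" using profile
    by (simp add: B_def b_0 is_profile_def sum_distrib_right[symmetric])
  then show ?case by (simp add: N_def real_choose_two)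
next
  case (Suc i)
  then interpret borda_round C "b i" "left i" "xs ! i" by (intro borda_round_at) auto
  obtain f where f: "is_chosen_flow C (b i) (left i) (xs ! i) f"
    and b: "\<And>r. r \<in> rankings C \<Longrightarrow> b (Suc i) r = b i r - src_flow (left i) (xs ! i) f r"
    using chosen_flow[of i] Suc.prems by auto
  have IH: "B i = k * (k - 1) / 2" using Suc by simp
  moreover have "4 \<le> card (left i)" using Suc.prems by (simp add: card_left)
  ultimately have "flow_value C (left i) (xs ! i) f = k - 1"
    using f by (intro chosen_flow_large_round(1)) (auto simp: B_def)
  then have "B (Suc i) = k * (k - 1) / 2 - (k - 1)" using B_Suc[OF b] IH by simp
  moreover have "real (card (left (Suc i))) = k - 1" using Suc.prems by (simp add: card_left)
  moreover have "t * (t - 1) / 2 - (t - 1) = (t - 1) * (t - 1 - 1) / 2" for t :: real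
    by (simp add: field_simps)
  ultimately show ?case by (simp only:)
qed

section \<open>Utility of the subprofile, round by round\<close>

lemma V_nonneg: "0 \<le> V i"
  using sub by (auto simp: V_def intro!: sum_nonneg)

text \<open>Budgets never grow, so the group's remaining budget at a ranking is at most its initial
  one, \<open>S r * N\<close>. This passes from budget weights to the weights
  \<open>S\<close>.\<close>

lemma utility_ge:
  assumes "i < card C"
  shows "(\<Sum>r\<in>rankings C. \<alpha> r * b i r * real (u_cand r (xs ! i) (left i))) \<le> N * V i"
proof -
  have "\<alpha> r * b i r \<le> S r * N" if "r \<in> rankings C" for r
    using mult_left_mono[of "b i r" "b 0 r" "\<alpha> r"] budget_bounds[of i r] \<alpha>_bounds[of r] \<alpha>_b_0[of r]
      that assms by auto
  then have "(\<Sum>r\<in>rankings C. \<alpha> r * b i r * real (u_cand r (xs ! i) (left i)))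
      \<le> (\<Sum>r\<in>rankings C. S r * N * real (u_cand r (xs ! i) (left i)))"
    by (intro sum_mono mult_right_mono) auto
  also have "\<dots> = N * V i" by (simp add: V_def sum_distrib_left mult_ac)
  finally show ?thesis .
qed

lemma q_le_q_0: "i \<le> card C \<Longrightarrow> q i \<le> q 0"
  unfolding q_def using budget_bounds[of i] \<alpha>_bounds by (intro sum_mono mult_left_mono) auto

lemma q_nonneg: "i \<le> card C \<Longrightarrow> 0 \<le> q i"
  unfolding q_def using budget_bounds[of i] \<alpha>_bounds by (intro sum_nonneg mult_nonneg_nonneg) auto

lemma q_le_B: "i \<le> card C \<Longrightarrow> q i \<le> B i"
  unfolding q_def B_def using budget_bounds[of i] \<alpha>_bounds
  by (intro sum_mono mult_left_le_one_le) auto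

lemma utility_early_rounds:
  assumes "i + 3 \<le> card C"
  shows "((q 0)\<^sup>2 - (q i)\<^sup>2) / 4 \<le> N * (\<Sum>j<i. V j)"
  using assms
proof (induction i)
  case 0
  then show ?case by simp
next
  case (Suc i)
  then interpret borda_round C "b i" "left i" "xs ! i" by (intro borda_round_at) auto
  obtain f where f: "is_chosen_flow C (b i) (left i) (xs ! i) f"
    and b: "\<And>r. r \<in> rankings C \<Longrightarrow> b (Suc i) r = b i r - src_flow (left i) (xs ! i) f r"
    using chosen_flow[of i] Suc.prems by auto
  have qS: "q (Suc i) = (\<Sum>r\<in>rankings C. \<alpha> r * (b i r - src_flow (left i) (xs ! i) f r))"
    by (intro q_Suc b)
  have "((q i)\<^sup>2 - (q (Suc i))\<^sup>2) / 4
      \<le> (\<Sum>r\<in>rankings C. \<alpha> r * b i r * real (u_cand r (xs ! i) (left i)))"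
    unfolding qS unfolding q_def using f B_eq[of i] Suc.prems
    by (intro group_utility_large_round \<alpha>_bounds) (auto simp: B_def card_left)
  also have "\<dots> \<le> N * V i" using Suc.prems by (intro utility_ge) auto
  finally show ?case using Suc by (simp add: distrib_left)
qed

lemma utility_two_left:
  assumes "i + 2 = card C"
  shows "q i - B i / 2 \<le> N * V i"
proof -
  interpret borda_round C "b i" "left i" "xs ! i" using assms by (intro borda_round_at) auto
  have "q i - B i / 2 \<le> (\<Sum>r\<in>rankings C. \<alpha> r * b i r * real (u_cand r (xs ! i) (left i)))"
    unfolding q_def B_def using assms
    by (intro group_utility_two_left \<alpha>_bounds) (auto simp: card_left)
  then show ?thesis using utility_ge[of i] assms by simp
qed

text \<open>The payment in this round is matched by utility. At most \<open>3 - 3 / 2\<close> of the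
  total budget remains, and the next round loses at most half of it, which is
  \<open>3 / 4\<close>.\<close>

lemma utility_three_left:
  assumes "i + 3 = card C"
  shows "q i - 3 / 4 \<le> N * (V i + V (Suc i))"
proof -
  interpret borda_round C "b i" "left i" "xs ! i" using assms by (intro borda_round_at) auto
  obtain f where f: "is_chosen_flow C (b i) (left i) (xs ! i) f"
    and b: "\<And>r. r \<in> rankings C \<Longrightarrow> b (Suc i) r = b i r - src_flow (left i) (xs ! i) f r"
    using chosen_flow[of i] assms by auto
  then have fmax: "is_max_flow C (b i) (left i) (xs ! i) f" by (simp add: is_chosen_flow_def)
  have qS: "q (Suc i) = (\<Sum>r\<in>rankings C. \<alpha> r * (b i r - src_flow (left i) (xs ! i) f r))"
    by (intro q_Suc b)
  have card3: "card (left i) = 3" using assms by (simp add: card_left)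
  then have B3: "B i = 3" using B_eq[of i] assms by simp
  have "3 / 2 \<le> flow_value C (left i) (xs ! i) f"
    using max_flow_three_left[OF card3 _ fmax] B3 by (simp add: B_def)
  then have "B (Suc i) \<le> 3 / 2" using B_Suc[OF b] B3 by simp
  moreover have "q i - q (Suc i) \<le> N * V i"
  proof -
    have "is_flow C (b i) (left i) (xs ! i) f" using fmax by (simp add: is_max_flow_def)
    then have "q i - q (Suc i) \<le> (\<Sum>r\<in>rankings C. \<alpha> r * b i r * real (u_cand r (xs ! i) (left i)))"
      unfolding qS unfolding q_def by (intro group_utility_ge_payment \<alpha>_bounds)
    then show ?thesis using utility_ge[of i] assms by simp
  qed
  moreover have "q (Suc i) - B (Suc i) / 2 \<le> N * V (Suc i)"
    using utility_two_left[of "Suc i"] assms by simp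
  ultimately show ?thesis by (simp add: distrib_left)
qed

lemma total_utility: "(q 0)\<^sup>2 / 4 - 3 / 16 * q 0 \<le> N * (\<Sum>j<card C. V j)"
proof -
  consider "card C \<le> 1" | "card C = 2" | "3 \<le> card C" by linarith
  then show ?thesis
  proof cases
    case 1
    then have "N = 0" by (simp add: N_def)
    then have "q 0 = 0" by (simp add: q_def b_0)
    then show ?thesis using \<open>N = 0\<close> by simp
  next
    case 2
    \<comment> \<open>With two candidates the total budget is 1, so the loss is only
      \<open>1 / 2\<close>, within the \<open>3 / 4\<close> allowed by
      \<open>final_rounds_bound\<close>.\<close>
    have "q 0 - B 0 / 2 \<le> N * V 0" using utility_two_left[of 0] 2 by simp
    moreover have "B 0 = 1"
      using profile 2 by (simp add: B_def b_0 N_def is_profile_def)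
    moreover have "0 \<le> N * V 1" "0 \<le> N * V 0" using N_nonneg V_nonneg by auto
    moreover have "(\<Sum>j<card C. V j) = V 0 + V 1" by (simp add: 2 numeral_2_eq_2)
    ultimately show ?thesis
      using q_nonneg[of 0] q_le_B[of 0] by (intro final_rounds_bound) (auto simp: distrib_left)
  next
    case 3
    define i where "i = card C - 3"
    have i: "i + 3 = card C" using 3 by (simp add: i_def)
    have "card (left i) = 3" using card_left[of i] i by simp
    then have "B i = 3" using B_eq[of i] i by simp
    then have "q i \<le> 3" using q_le_B[of i] i by simp
    moreover have "0 \<le> N * (V i + V (Suc i))" using N_nonneg V_nonneg by simp
    ultimately have "(q i)\<^sup>2 / 4 - 3 / 16 * q i \<le> N * (V i + V (Suc i))"
      using utility_three_left[OF i] q_nonneg[of i] i by (intro final_rounds_bound) auto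
    moreover have "((q 0)\<^sup>2 - (q i)\<^sup>2) / 4 \<le> N * (\<Sum>j<i. V j)"
      using utility_early_rounds i by simp
    \<comment> \<open>Replaces the linear loss in \<open>q i\<close> by one in \<open>q 0\<close>;
      the quadratic terms in \<open>q i\<close> cancel.\<close>
    moreover have "q i \<le> q 0" using q_le_q_0[of i] i by simp
    moreover have "card C = Suc (Suc (Suc i))" using i by simp
    then have "(\<Sum>j<card C. V j) = (\<Sum>j<i. V j) + (V i + V (Suc i)) + V (Suc (Suc i))" by simp
    then have "N * (\<Sum>j<card C. V j) = N * (\<Sum>j<i. V j) + N * (V i + V (Suc i)) + N * V (Suc (Suc i))"
      by (simp add: distrib_left)
    moreover have "0 \<le> N * V (Suc (Suc i))" using N_nonneg V_nonneg by simp
    ultimately show ?thesis by argo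
  qed
qed

lemma q_0: "q 0 = N * (\<Sum>r\<in>rankings C. S r)"
proof -
  have "q 0 = (\<Sum>r\<in>rankings C. S r * N)" unfolding q_def by (intro sum.cong refl \<alpha>_b_0)
  then show ?thesis by (simp add: sum_distrib_left mult.commute)
qed

lemma sum_V: "(\<Sum>i<card C. V i) = (\<Sum>r\<in>rankings C. S r * real (u_pair r (ranking_of xs)))"
  unfolding V_def u_pair_ranking_of[OF xs(1)]
  by (subst sum.swap) (simp add: xs sum_distrib_left)

end

theorem mainTheorem12:
  fixes C :: "'a set" and R S :: "'a rel \<Rightarrow> real"
    and xs :: "'a list" and b :: "nat \<Rightarrow> 'a rel \<Rightarrow> real"
  assumes "finite C"
    and "is_profile C R"
    and "FAB_run C R xs b"
    and "\<forall>r\<in>rankings C. 0 \<le> S r \<and> S r \<le> R r"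
    and "(\<Sum>r\<in>rankings C. S r) > 0"
  shows "(1 / (\<Sum>r\<in>rankings C. S r)) * (\<Sum>r\<in>rankings C. S r * real (u_pair r (ranking_of xs)))
           \<ge> real (card C choose 2) * (\<Sum>r\<in>rankings C. S r) / 4 - 3 / 16"
proof -
  interpret fab_subprofile C R S xs b using assms by unfold_locales
  define \<sigma> where "\<sigma> = (\<Sum>r\<in>rankings C. S r)"
  define W where "W = (\<Sum>i<card C. V i)"
  have "0 < \<sigma>" using assms by (simp add: \<sigma>_def)
  have "N * \<sigma> / 4 - 3 / 16 \<le> W / \<sigma>"
  \<comment> \<open>With at most one candidate, \<open>N\<close> cannot be cancelled, but then the
    claimed bound is negative.\<close>
  proof (cases "N = 0")
    case True
    have "0 \<le> W" using V_nonneg by (auto simp: W_def intro: sum_nonneg)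
    then have "0 \<le> W / \<sigma>" using \<open>0 < \<sigma>\<close> by simp
    then show ?thesis using True by simp
  next
    case False
    then have "0 < N" using N_nonneg by simp
    have "(N * \<sigma>)\<^sup>2 / 4 - 3 / 16 * (N * \<sigma>) \<le> N * W"
      using total_utility unfolding q_0 W_def \<sigma>_def .
    then have "N * (\<sigma> * (N * \<sigma> / 4 - 3 / 16)) \<le> N * W"
      by (simp add: power2_eq_square algebra_simps)
    then have "\<sigma> * (N * \<sigma> / 4 - 3 / 16) \<le> W" using \<open>0 < N\<close> by simp
    then show ?thesis using \<open>0 < \<sigma>\<close> by (subst pos_le_divide_eq) (simp_all add: mult.commute)
  qed
  then show ?thesis unfolding sum_V[symmetric] \<sigma>_def W_def N_def by simp
qed

end
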